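(* Let $f$ be as in the context. Then the algorithm $\textsc{Dcm}$ (described in the context) applied to $f$ terminates and returns a list $\mathcal{O}=\{I_1,\dots,I_m\}$ of pairwise disjoint intervals such that each $I_k$ is isolating for a real root of $f$ (contains exactly one real root of $f$) and every real root of $f$ lies in some $I_k$.
   Context: Let $F(x)=\sum_{i=0}^nA_ix^i\in\mathbb{R}[x]$ be square-free of degree $n\ge2$ with $|A_n|\ge1$ and complex roots $\xi_i$; let $\Gamma$ be an integer with $\log_2\max_i|\xi_i|\le\Gamma<4\log_2n+\log_2\max_i|\xi_i|$ and $f(x):=F(2^{\Gamma+1}x)/A_n$ (all roots of $f$ have modulus at most $1/2$). Notation: for an interval $I=(a,b)$, $w(I)=b-a$, $m(I)=(a+b)/2$, $I^+=(a^+,b^+):=(a-\frac{w(I)}{4n},b+\frac{w(I)}{4n})$, $f_I(x):=f(a+w(I)x)$. $\operatorname{var}(p)$ is the number of sign changes in the coefficient sequence of a real polynomial $p$ (zeros ignored) and $\operatorname{var}(f,I):=\operatorname{var}((1+x)^nf_I(\frac1{1+x}))$. For a polynomial $p$, $t_{3/2}^p(m,r):=|p(m)|-\frac32\sum_{k\ge1}|p^{(k)}(m)/k!|r^k$ and $\mathcal{T}^p(m,r)$ holds iff $t_{3/2}^p(m,r)>0$. Algorithm $\textsc{Dcm}$ (exact real arithmetic): keep a set $\mathcal{A}$ of active intervals, initially $\{(-\frac12,\frac12)\}$, and a list $\mathcal{O}=\emptyset$. While $\mathcal{A}\ne\emptyset$, remove some $I=(a,b)$ from $\mathcal{A}$.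 If $\operatorname{var}(f,I^+)=0$, discard $I$. Otherwise, if $\mathcal{T}^{(f_I)'}(0,2)$ fails, add $(a,m(I))$ and $(m(I),b)$ to $\mathcal{A}$. Otherwise, if $f(a^+)f(b^+)<0$ and $I^+$ is disjoint from every interval already in $\mathcal{O}$, add $I^+$ to $\mathcal{O}$; else discard $I$. Output $\mathcal{O}$ when $\mathcal{A}$ is empty. *)

theory Defs
  imports "HOL-Analysis.Analysis" "HOL-Computational_Algebra.Computational_Algebra"
begin

text \<open>The pair \<open>(a, b)\<close> encodes the open interval from \<open>a\<close> to \<open>b\<close>.\<close>

type_synonym ivl = "real \<times> real"

definition ivl_set :: "ivl \<Rightarrow> real set" where
  "ivl_set I = {fst I<..<snd I}"

definition width :: "ivl \<Rightarrow> real" where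
  "width I = snd I - fst I"

definition midpt :: "ivl \<Rightarrow> real" where
  "midpt I = (fst I + snd I) / 2"

definition enlarge :: "nat \<Rightarrow> ivl \<Rightarrow> ivl" where
  "enlarge n I = (fst I - width I / (4 * real n), snd I + width I / (4 * real n))"

definition max_root_modulus :: "real poly \<Rightarrow> real" where
  "max_root_modulus F = Max (cmod ` {\<xi>. poly (map_poly complex_of_real F) \<xi> = 0})"

definition scaled_poly :: "real poly \<Rightarrow> int \<Rightarrow> real poly" where
  "scaled_poly F \<Gamma> = smult (1 / lead_coeff F) (F \<circ>\<^sub>p [:0, 2 powi (\<Gamma> + 1):])"

lemma poly_scaled_poly:
  "poly (scaled_poly F \<Gamma>) x = poly F (2 powi (\<Gamma> + 1) * x) / lead_coeff F"
  by (simp add: scaled_poly_def poly_pcompose mult.commute)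

definition ivl_poly :: "real poly \<Rightarrow> ivl \<Rightarrow> real poly" where
  "ivl_poly f I = f \<circ>\<^sub>p [:fst I, width I:]"

lemma poly_ivl_poly: "poly (ivl_poly f I) x = poly f (fst I + width I * x)"
  by (simp add: ivl_poly_def poly_pcompose mult.commute)

text \<open>A sign change is a pair of nonzero coefficients of opposite sign, all coefficients in
  between being zero.\<close>

definition var :: "real poly \<Rightarrow> nat" where
  "var p = card {(i, j). i < j \<and> coeff p i * coeff p j < 0 \<and>
                         (\<forall>k. i < k \<and> k < j \<longrightarrow> coeff p k = 0)}"

text \<open>For \<open>degree p \<le> n\<close>, this is \<open>(1 + x)^n p(1 / (1 + x))\<close> as a polynomial in \<open>x\<close>.\<close>

definition moebius_poly :: "nat \<Rightarrow> real poly \<Rightarrow> real poly" where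
  "moebius_poly n p = (\<Sum>i\<le>n. smult (coeff p i) ([:1, 1:] ^ (n - i)))"

lemma poly_moebius_poly:
  assumes "degree p \<le> n" "x \<noteq> -1"
  shows "poly (moebius_poly n p) x = (1 + x) ^ n * poly p (1 / (1 + x))"
proof -
  have x: "1 + x \<noteq> 0" using assms(2) by (metis add.commute add_eq_0_iff)
  have "poly p (1 / (1 + x)) = (\<Sum>i\<le>n. coeff p i * (1 / (1 + x)) ^ i)"
    unfolding poly_altdef using assms(1)
    by (intro sum.mono_neutral_left) (auto simp: coeff_eq_0)
  then have "(1 + x) ^ n * poly p (1 / (1 + x)) =
      (\<Sum>i\<le>n. coeff p i * ((1 + x) ^ n * (1 / (1 + x)) ^ i))"
    by (simp add: sum_distrib_left mult_ac)
  also have "\<dots> = (\<Sum>i\<le>n. coeff p i * (1 + x) ^ (n - i))"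
    using x by (intro sum.cong) (auto simp: power_diff power_divide)
  finally show ?thesis
    by (simp add: moebius_poly_def poly_sum)
qed

definition var_ivl :: "real poly \<Rightarrow> ivl \<Rightarrow> nat" where
  "var_ivl f I = var (moebius_poly (degree f) (ivl_poly f I))"

definition t32 :: "real poly \<Rightarrow> real \<Rightarrow> real \<Rightarrow> real" where
  "t32 p m r = \<bar>poly p m\<bar> -
     3 / 2 * (\<Sum>k = 1..degree p. \<bar>poly ((pderiv ^^ k) p) m / fact k\<bar> * r ^ k)"

definition T32 :: "real poly \<Rightarrow> real \<Rightarrow> real \<Rightarrow> bool" where
  "T32 p m r \<longleftrightarrow> t32 p m r > 0"

definition dcm_accept :: "real poly \<Rightarrow> ivl list \<Rightarrow> ivl \<Rightarrow> bool" where
  "dcm_accept f Out J \<longleftrightarrow> poly f (fst J) * poly f (snd J) < 0 \<and>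
     (\<forall>K \<in> set Out. ivl_set J \<inter> ivl_set K = {})"

text \<open>A state consists of the set of active intervals and the output list so far. The choice of
  the active interval to be processed next is arbitrary, so one iteration of the loop is a
  relation.\<close>

inductive dcm_step :: "real poly \<Rightarrow> ivl set \<times> ivl list \<Rightarrow> ivl set \<times> ivl list \<Rightarrow> bool"
  for f :: "real poly" where
  no_root:
    "\<lbrakk>I \<in> A; var_ivl f (enlarge (degree f) I) = 0\<rbrakk>
     \<Longrightarrow> dcm_step f (A, Out) (A - {I}, Out)"
| subdivide:
    "\<lbrakk>I \<in> A; var_ivl f (enlarge (degree f) I) \<noteq> 0; \<not> T32 (pderiv (ivl_poly f I)) 0 2\<rbrakk>
     \<Longrightarrow> dcm_step f (A, Out) (A - {I} \<union> {(fst I, midpt I), (midpt I, snd I)}, Out)"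
| accept:
    "\<lbrakk>I \<in> A; var_ivl f (enlarge (degree f) I) \<noteq> 0; T32 (pderiv (ivl_poly f I)) 0 2;
      dcm_accept f Out (enlarge (degree f) I)\<rbrakk>
     \<Longrightarrow> dcm_step f (A, Out) (A - {I}, Out @ [enlarge (degree f) I])"
| reject:
    "\<lbrakk>I \<in> A; var_ivl f (enlarge (degree f) I) \<noteq> 0; T32 (pderiv (ivl_poly f I)) 0 2;
      \<not> dcm_accept f Out (enlarge (degree f) I)\<rbrakk>
     \<Longrightarrow> dcm_step f (A, Out) (A - {I}, Out)"

lemma dcm_step_progress: "A \<noteq> {} \<Longrightarrow> \<exists>s. dcm_step f (A, Out) s"
  by (meson all_not_in_conv dcm_step.intros)

lemma dcm_step_final: "\<not> dcm_step f ({}, Out) s"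
  by (auto elim: dcm_step.cases)

definition dcm_init :: "ivl set \<times> ivl list" where
  "dcm_init = ({(-1/2, 1/2)}, [])"

definition dcm_terminates :: "real poly \<Rightarrow> bool" where
  "dcm_terminates f \<longleftrightarrow>
     \<not> (\<exists>s. s 0 = dcm_init \<and> (\<forall>i::nat. dcm_step f (s i) (s (Suc i))))"

definition dcm_returns :: "real poly \<Rightarrow> ivl list \<Rightarrow> bool" where
  "dcm_returns f Out \<longleftrightarrow> (dcm_step f)\<^sup>*\<^sup>* dcm_init ({}, Out)"

definition isolating :: "real poly \<Rightarrow> ivl \<Rightarrow> bool" where
  "isolating f I \<longleftrightarrow> (\<exists>!x. x \<in> ivl_set I \<and> poly f x = 0)"

end

theory Submission
  imports Defs
begin

text \<open>
  If \<open>var\<close> vanishes on \<open>I\<^sup>+\<close>, then \<open>I\<^sup>+\<close> contains no root. If \<open>I = (a, b)\<close> passes the \<open>T32\<close> test,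
  then \<open>f'\<close> has no zero within distance \<open>2 w(I)\<close> of \<open>a\<close>, in particular none on \<open>I\<^sup>+\<close>; hence a root
  in \<open>I\<close> forces a sign change at the ends of \<open>I\<^sup>+\<close>, and if \<open>I\<^sup>+\<close> meets an interval of the output,
  both contain the same root. So no root is ever lost.

  Termination: \<open>f\<close> and \<open>f'\<close> have no common zero, so \<open>|f| + |f'|\<close> is bounded below on \<open>[-1, 1]\<close>.
  On a short interval a large \<open>|f(a)|\<close> makes \<open>var\<close> vanish and a large \<open>|f'(a)|\<close> makes the \<open>T32\<close>
  test succeed. As only long intervals are subdivided, each step lowers the sum of the squared
  widths of the active intervals by a fixed amount.
\<close>

section \<open>Sign variations and absence of roots\<close>

text \<open>\<open>var\<close> only compares neighbouring nonzero coefficients. Induction on the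
  distance \<open>j - i\<close> reaches all pairs: between two coefficients of opposite sign lies a
  nonzero one, which agrees in sign with both.\<close>

lemma coeff_mult_nonneg_if_var_eq_0:
  assumes "var p = 0"
  shows "coeff p i * coeff p j \<ge> 0"
proof -
  let ?S = "{(i, j). i < j \<and> coeff p i * coeff p j < 0 \<and>
                     (\<forall>k. i < k \<and> k < j \<longrightarrow> coeff p k = 0)}"
  \<comment> \<open>Since \<open>card\<close> is 0 on infinite sets, \<open>var p = 0\<close> means
    emptiness only once \<open>?S\<close> is known to be finite.\<close>
  have "?S \<subseteq> {..degree p} \<times> {..degree p}"
    by (auto intro!: le_degree)
  then have "finite ?S" by (rule finite_subset) simp
  with assms have empty: "?S = {}" by (simp add: var_def)
  have lt: "coeff p i * coeff p j \<ge> 0" if "i < j" for i j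
    using that
  proof (induction "j - i" arbitrary: i j rule: less_induct)
    case less
    show ?case
    proof (rule ccontr)
      assume "\<not> coeff p i * coeff p j \<ge> 0"
      with empty less.prems obtain k where k: "i < k" "k < j" "coeff p k \<noteq> 0"
        by (auto simp: not_le)
      have "coeff p i * coeff p k \<ge> 0" "coeff p k * coeff p j \<ge> 0"
        using k by (auto intro!: less.hyps)
      with k(3) \<open>\<not> coeff p i * coeff p j \<ge> 0\<close> show False
        by (smt (verit) mult_nonneg_nonneg mult_nonpos_nonpos zero_le_mult_iff)
    qed
  qed
  show ?thesis
    using lt[of i j] lt[of j i] by (cases i j rule: linorder_cases) (auto simp: mult.commute)
qed

text \<open>The case of no sign change in Descartes' rule: multiplied by the leading coefficient,
  every term is nonnegative at \<open>x\<close> and the top one is positive.\<close>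

lemma poly_nonzero_if_var_eq_0:
  assumes "var p = 0" "p \<noteq> 0" "x > 0"
  shows "poly p x \<noteq> 0"
proof -
  let ?n = "degree p"
  have lc: "coeff p ?n \<noteq> 0" using assms(2) by simp
  have "0 < coeff p ?n * (coeff p ?n * x ^ ?n)"
    using lc assms(3) by (simp add: power2_eq_square[symmetric] flip: mult.assoc)
  also have "\<dots> \<le> (\<Sum>i\<le>?n. coeff p ?n * (coeff p i * x ^ i))"
    using assms(3) coeff_mult_nonneg_if_var_eq_0[OF assms(1)]
    by (intro member_le_sum) (auto simp flip: mult.assoc)
  also have "\<dots> = coeff p ?n * poly p x"
    by (simp add: poly_altdef sum_distrib_left)
  finally show ?thesis by auto
qed

lemma var_eq_0I:
  assumes "\<And>i j. coeff p i * coeff p j \<ge> 0"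
  shows "var p = 0"
proof -
  have "{(i, j). i < j \<and> coeff p i * coeff p j < 0 \<and>
         (\<forall>k. i < k \<and> k < j \<longrightarrow> coeff p k = 0)} = {}"
    using assms by (auto simp: not_less[symmetric])
  then show ?thesis unfolding var_def by (metis card.empty)
qed

lemma degree_ivl_poly:
  assumes "width I \<noteq> 0"
  shows "degree (ivl_poly f I) = degree f"
  using assms by (simp add: ivl_poly_def degree_pcompose)

lemma no_root_if_var_ivl_eq_0:
  assumes "var_ivl f I = 0" "f \<noteq> 0" "x \<in> ivl_set I"
  shows "poly f x \<noteq> 0"
proof
  assume root: "poly f x = 0"
  have x: "fst I < x" "x < snd I" using assms(3) by (auto simp: ivl_set_def)
  then have w: "width I > 0" by (simp add: width_def)
  let ?p = "ivl_poly f I"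
  let ?q = "moebius_poly (degree f) ?p"
  have deg: "degree ?p \<le> degree f" using w by (simp add: degree_ivl_poly)
  \<comment> \<open>The inverse of \<open>fst I + width I / (1 + y)\<close>, which maps the positive
    half-line onto the open interval: a root in \<open>I\<close> becomes a positive root of
    \<open>?q\<close>.\<close>
  define y where "y = (snd I - x) / (x - fst I)"
  have y: "y > 0" using x by (simp add: y_def)
  have "1 / (1 + y) = (x - fst I) / width I"
    using x by (simp add: y_def width_def field_simps)
  then have "poly ?p (1 / (1 + y)) = poly f x"
    using w by (simp add: poly_ivl_poly)
  then have "poly ?q y = 0"
    using root y deg by (subst poly_moebius_poly) auto
  \<comment> \<open>The zero polynomial also has \<open>var\<close> 0. If \<open>?q\<close> were
    zero, \<open>f\<close> would vanish on the whole interval.\<close>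
  moreover have "?q \<noteq> 0"
  proof
    assume "?q = 0"
    have "{fst I<..<snd I} \<subseteq> {z. poly f z = 0}"
    proof safe
      fix z assume z: "z \<in> {fst I<..<snd I}"
      define y where "y = (snd I - z) / (z - fst I)"
      have y: "y > 0" using z by (simp add: y_def)
      have eq: "1 / (1 + y) = (z - fst I) / width I"
        using z by (simp add: y_def width_def field_simps)
      have "0 = (1 + y) ^ degree f * poly ?p (1 / (1 + y))"
        using \<open>?q = 0\<close> y deg by (subst poly_moebius_poly[symmetric]) auto
      then show "poly f z = 0" using y w by (simp add: poly_ivl_poly eq)
    qed
    then have "finite {fst I<..<snd I}"
      using poly_roots_finite[OF assms(2)] finite_subset by blast
    then show False using x infinite_Ioo[of "fst I" "snd I"] by simp
  qed
  ultimately show False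
    using poly_nonzero_if_var_eq_0[of ?q y] y assms(1) by (simp add: var_ivl_def)
qed

section \<open>The \<open>T32\<close> test and zeros of the derivative\<close>

lemma poly_split_coeff_0:
  fixes p :: "'a::comm_ring_1 poly"
  shows "poly p x = coeff p 0 + (\<Sum>k = 1..degree p. coeff p k * x ^ k)"
proof -
  have "{..degree p} = insert 0 {1..degree p}" by auto
  then show ?thesis by (simp add: poly_altdef)
qed

lemma t32_at_0: "t32 p 0 r = \<bar>coeff p 0\<bar> - 3 / 2 * (\<Sum>k = 1..degree p. \<bar>coeff p k\<bar> * r ^ k)"
proof -
  have "poly ((pderiv ^^ k) p) 0 / fact k = coeff p k" for k
    by (simp add: poly_0_coeff_0 coeff_higher_pderiv pochhammer_fact[symmetric])
  then show ?thesis by (simp add: t32_def poly_0_coeff_0)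
qed

text \<open>At a zero the constant term would be balanced by the other terms, but the test makes it
  larger than 3/2 times a bound on their absolute sum.\<close>

lemma poly_nonzero_if_T32:
  assumes "T32 p 0 r" "\<bar>x\<bar> \<le> r"
  shows "poly p x \<noteq> 0"
proof
  assume "poly p x = 0"
  then have "\<bar>coeff p 0\<bar> = \<bar>\<Sum>k = 1..degree p. coeff p k * x ^ k\<bar>"
    using poly_split_coeff_0[of p x] by simp
  also have "\<dots> \<le> (\<Sum>k = 1..degree p. \<bar>coeff p k * x ^ k\<bar>)" by (rule sum_abs)
  also have "\<dots> \<le> (\<Sum>k = 1..degree p. \<bar>coeff p k\<bar> * r ^ k)"
    using assms(2)
    by (intro sum_mono) (auto simp: abs_mult power_abs intro!: mult_left_mono power_mono)
  finally have le: "\<bar>coeff p 0\<bar> \<le> (\<Sum>k = 1..degree p. \<bar>coeff p k\<bar> * r ^ k)" .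
  have "0 \<le> (\<Sum>k = 1..degree p. \<bar>coeff p k\<bar> * r ^ k)"
    using assms(2) by (intro sum_nonneg) auto
  with le assms(1) show False by (simp add: T32_def t32_at_0)
qed

text \<open>By the chain rule, the derivative of \<open>ivl_poly f I\<close> at
  \<open>(x - fst I) / width I\<close> is \<open>width I\<close> times that of \<open>f\<close> at
  \<open>x\<close>; radius 2 thus becomes distance \<open>2 * width I\<close>.\<close>

lemma pderiv_nonzero_if_T32:
  assumes "T32 (pderiv (ivl_poly f I)) 0 2" "width I > 0" "\<bar>x - fst I\<bar> \<le> 2 * width I"
  shows "poly (pderiv f) x \<noteq> 0"
proof -
  have "\<bar>(x - fst I) / width I\<bar> \<le> 2"
    using assms(2,3) by (simp add: field_simps)
  from poly_nonzero_if_T32[OF assms(1) this] show ?thesis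
    using assms(2) by (simp add: ivl_poly_def pderiv_pcompose poly_pcompose pderiv_pCons)
qed

text \<open>Rolle's theorem; \<open>min\<close> and \<open>max\<close> spare the caller from
  ordering the two roots.\<close>

lemma roots_eq_if_pderiv_nonzero:
  fixes f :: "real poly"
  assumes "\<And>z. min x y < z \<Longrightarrow> z < max x y \<Longrightarrow> poly (pderiv f) z \<noteq> 0"
    and "poly f x = 0" "poly f y = 0"
  shows "x = y"
proof (rule ccontr)
  assume "x \<noteq> y"
  then have "min x y < max x y" by auto
  from poly_MVT[OF this, of f] obtain z where
    "min x y < z" "z < max x y" "(max x y - min x y) * poly (pderiv f) z = 0"
    using assms(2,3) by (auto simp: min_def max_def split: if_splits)
  with assms(1) \<open>x \<noteq> y\<close> show False by (auto simp: min_def max_def split: if_splits)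
qed

text \<open>By the mean value theorem \<open>f\<close> is \<open>-(x - a) f'(u)\<close> at
  \<open>a\<close> and \<open>(b - x) f'(v)\<close> at \<open>b\<close>, and \<open>f'\<close> keeps
  its sign between \<open>u\<close> and \<open>v\<close>.\<close>

lemma sign_change_if_pderiv_nonzero:
  fixes f :: "real poly"
  assumes "\<And>z. a \<le> z \<Longrightarrow> z \<le> b \<Longrightarrow> poly (pderiv f) z \<noteq> 0"
    and "a < x" "x < b" "poly f x = 0"
  shows "poly f a * poly f b < 0"
proof (rule ccontr)
  assume "\<not> poly f a * poly f b < 0"
  obtain u where u: "a < u" "u < x" "poly f x - poly f a = (x - a) * poly (pderiv f) u"
    using poly_MVT[OF assms(2), of f] by auto
  obtain v where v: "x < v" "v < b" "poly f b - poly f x = (b - x) * poly (pderiv f) v"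
    using poly_MVT[OF assms(3), of f] by auto
  have "poly f a * poly f b = - ((x - a) * (b - x)) * (poly (pderiv f) u * poly (pderiv f) v)"
  proof -
    have "poly f a = - ((x - a) * poly (pderiv f) u)" "poly f b = (b - x) * poly (pderiv f) v"
      using u(3) v(3) assms(4) by auto
    then show ?thesis by simp
  qed
  with \<open>\<not> _\<close> have "(x - a) * (b - x) * (poly (pderiv f) u * poly (pderiv f) v) \<le> 0"
    by simp
  moreover have "(x - a) * (b - x) > 0" using assms by simp
  ultimately have "poly (pderiv f) u * poly (pderiv f) v \<le> 0"
    by (meson mult_pos_pos not_le)
  moreover have "poly (pderiv f) u \<noteq> 0" "poly (pderiv f) v \<noteq> 0"
    using assms u v by auto
  ultimately have "poly (pderiv f) u * poly (pderiv f) v < 0"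
    by (simp add: less_le)
  then obtain z where "u < z" "z < v" "poly (pderiv f) z = 0"
    using poly_IVT[of u v "pderiv f"] u v by auto
  with assms(1)[of z] u v show False by auto
qed

lemma pderiv_nonzero_on_enlarge:
  assumes "T32 (pderiv (ivl_poly f I)) 0 2" "width I > 0" "n \<ge> 2"
    and "fst (enlarge n I) \<le> x" "x \<le> snd (enlarge n I)"
  shows "poly (pderiv f) x \<noteq> 0"
proof (rule pderiv_nonzero_if_T32[OF assms(1,2)])
  have "width I / (4 * real n) \<le> width I"
    using assms(2,3) by (simp add: divide_le_eq)
  then show "\<bar>x - fst I\<bar> \<le> 2 * width I"
    using assms(2,4,5) by (auto simp: enlarge_def width_def abs_le_iff)
qed

lemma enlarge_bounds:
  assumes "width I > 0" "n > 0"
  shows "fst (enlarge n I) < fst I" "snd I < snd (enlarge n I)"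
    "fst (enlarge n I) < snd (enlarge n I)"
proof -
  have "width I / (4 * real n) > 0" using assms by simp
  then show *: "fst (enlarge n I) < fst I" "snd I < snd (enlarge n I)"
    by (auto simp: enlarge_def)
  from assms(1) have "fst I < snd I" by (simp add: width_def)
  with * show "fst (enlarge n I) < snd (enlarge n I)" by linarith
qed

section \<open>Short intervals pass one of the two tests\<close>

text \<open>Horner's scheme: shifting \<open>pCons c f\<close> gives \<open>c + (a + x) * g\<close>
  with \<open>g\<close> the shift of \<open>f\<close>, so a bound \<open>M\<close> for
  \<open>g\<close> becomes \<open>\<bar>c\<bar> + 2 * M\<close>, uniformly in \<open>a\<close> and
  \<open>k\<close>.\<close>

lemma coeff_shift_bounded:
  fixes f :: "real poly"
  shows "\<exists>M\<ge>0. \<forall>a k. \<bar>a\<bar> \<le> 1 \<longrightarrow> \<bar>coeff (f \<circ>\<^sub>p [:a, 1:]) k\<bar> \<le> M"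
proof (induction f)
  case 0
  then show ?case by auto
next
  case (pCons c f)
  then obtain M where M: "M \<ge> 0" "\<And>a k. \<bar>a\<bar> \<le> 1 \<Longrightarrow> \<bar>coeff (f \<circ>\<^sub>p [:a, 1:]) k\<bar> \<le> M"
    by blast
  have "\<bar>coeff (pCons c f \<circ>\<^sub>p [:a, 1:]) k\<bar> \<le> \<bar>c\<bar> + 2 * M" if a: "\<bar>a\<bar> \<le> 1" for a k
  proof -
    let ?g = "f \<circ>\<^sub>p [:a, 1:]"
    have am: "\<bar>a * coeff ?g k\<bar> \<le> M"
      using mult_mono[OF a M(2)[OF a, of k]] by (simp add: abs_mult)
    show ?thesis
    proof (cases k)
      case 0
      then show ?thesis using am M(1) by (simp add: pcompose_pCons)
    next
      case (Suc j)
      then show ?thesis using am M(2)[OF a, of j] by (simp add: pcompose_pCons)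
    qed
  qed
  then show ?case using M(1) by (intro exI[of _ "\<bar>c\<bar> + 2 * M"]) auto
qed

text \<open>The substitution is a shift followed by a scaling. With the uniform bound on shifted
  coefficients, the coefficient of index \<open>k\<close> is of order
  \<open>width I ^ k\<close>.\<close>

lemma coeff_ivl_poly:
  "coeff (ivl_poly f I) k = width I ^ k * coeff (f \<circ>\<^sub>p [:fst I, 1:]) k"
proof -
  have "ivl_poly f I = (f \<circ>\<^sub>p [:fst I, 1:]) \<circ>\<^sub>p [:0, width I:]"
    by (simp add: ivl_poly_def pcompose_assoc[symmetric] pcompose_pCons)
  then show ?thesis by (simp add: coeff_pcompose_linear)
qed

lemma coeff_moebius_poly:
  "coeff (moebius_poly n p) j = (\<Sum>i\<le>n. coeff p i * real (n - i choose j))"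
proof -
  have "coeff ([:1, 1:] ^ m :: real poly) j = real (m choose j)" for m
    by (cases "j \<le> m") (auto simp: coeff_linear_poly_power coeff_eq_0 degree_linear_power)
  then show ?thesis by (simp add: moebius_poly_def coeff_sum)
qed

text \<open>Since \<open>(n - i choose j) \<le> (n choose j)\<close>, a dominating constant coefficient dictates the
  sign of every coefficient of the Moebius transform.\<close>

lemma var_moebius_poly_eq_0:
  assumes "(\<Sum>i = 1..n. \<bar>coeff p i\<bar>) < \<bar>coeff p 0\<bar>"
  shows "var (moebius_poly n p) = 0"
proof (rule var_eq_0I)
  let ?c = "coeff p 0" and ?q = "moebius_poly n p"
  have sgn: "?c * coeff ?q j \<ge> 0" for j
  proof -
    have split: "{..n} = insert 0 {1..n}" by auto
    have "\<bar>\<Sum>i = 1..n. coeff p i * real (n - i choose j)\<bar>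
          \<le> (\<Sum>i = 1..n. \<bar>coeff p i * real (n - i choose j)\<bar>)" by (rule sum_abs)
    also have "\<dots> \<le> (\<Sum>i = 1..n. \<bar>coeff p i\<bar> * real (n choose j))"
      by (intro sum_mono) (auto simp: abs_mult intro!: mult_left_mono binomial_right_mono)
    also have "\<dots> = (\<Sum>i = 1..n. \<bar>coeff p i\<bar>) * real (n choose j)"
      by (simp add: sum_distrib_right)
    also have "\<dots> \<le> \<bar>?c\<bar> * real (n choose j)"
      using assms by (intro mult_right_mono) auto
    finally have le: "\<bar>\<Sum>i = 1..n. coeff p i * real (n - i choose j)\<bar> \<le> \<bar>?c * real (n choose j)\<bar>"
      by (simp add: abs_mult)
    have eq: "coeff ?q j = ?c * real (n choose j) + (\<Sum>i = 1..n. coeff p i * real (n - i choose j))"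
      by (simp add: coeff_moebius_poly split)
    show ?thesis
    proof (cases "?c \<ge> 0")
      case True
      then have "?c * real (n choose j) \<ge> 0" by simp
      with le eq have "coeff ?q j \<ge> 0" by linarith
      with True show ?thesis by simp
    next
      case False
      then have "?c * real (n choose j) \<le> 0" by (simp add: mult_nonpos_nonneg)
      with le eq have "coeff ?q j \<le> 0" by linarith
      with False show ?thesis by (simp add: mult_nonpos_nonpos)
    qed
  qed
  have "?c \<noteq> 0"
  proof
    assume "?c = 0"
    moreover have "(\<Sum>i = 1..n. \<bar>coeff p i\<bar>) \<ge> 0" by (rule sum_nonneg) auto
    ultimately show False using assms by linarith
  qed
  then show "coeff ?q i * coeff ?q j \<ge> 0" for i j
    using sgn[of i] sgn[of j] by (auto simp: zero_le_mult_iff)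
qed

lemma sum_power_le_linear:
  fixes c :: "nat \<Rightarrow> real"
  assumes "\<And>k. \<bar>c k\<bar> \<le> M" "0 \<le> w" "w \<le> 1"
  shows "(\<Sum>k = 1..n. \<bar>c k\<bar> * w ^ k) \<le> w * (real n * M)"
proof -
  have "(\<Sum>k = 1..n. \<bar>c k\<bar> * w ^ k) \<le> (\<Sum>k = 1..n. M * w)"
  proof (rule sum_mono)
    fix k assume "k \<in> {1..n}"
    then have "w ^ k \<le> w"
      using power_decreasing[of 1 k w] assms(2,3) by auto
    then show "\<bar>c k\<bar> * w ^ k \<le> M * w"
      using assms(1)[of k] assms(2) by (intro mult_mono) auto
  qed
  then show ?thesis by (simp add: mult_ac)
qed

lemma small_ivl_not_subdivided:
  fixes f :: "real poly"
  assumes "degree f > 0" and simple: "\<And>x. poly f x = 0 \<Longrightarrow> poly (pderiv f) x \<noteq> 0"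
  shows "\<exists>\<delta>>0. \<forall>I. 0 < width I \<and> width I \<le> \<delta> \<and> \<bar>fst I\<bar> \<le> 1 / 2 \<longrightarrow>
    var_ivl f (enlarge (degree f) I) = 0 \<or> T32 (pderiv (ivl_poly f I)) 0 2"
proof -
  define n where "n = degree f"
  have n: "n \<ge> 1" using assms(1) by (simp add: n_def)
  obtain M where M: "M \<ge> 0" "\<And>a k. \<bar>a\<bar> \<le> 1 \<Longrightarrow> \<bar>coeff (f \<circ>\<^sub>p [:a, 1:]) k\<bar> \<le> M"
    using coeff_shift_bounded[of f] by blast
  let ?g = "\<lambda>x. \<bar>poly f x\<bar> + \<bar>poly (pderiv f) x\<bar>"
  \<comment> \<open>The minimum of \<open>?g\<close> is attained, hence positive. Of two numbers
    with sum at least \<open>2 * \<mu>\<close>, one is at least \<open>\<mu>\<close>.\<close>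
  have "continuous_on {-1..1} ?g" by (intro continuous_intros)
  then obtain x0 where x0: "\<And>x. x \<in> {-1..1} \<Longrightarrow> ?g x0 \<le> ?g x"
    using continuous_attains_inf[of "{-1..1}" ?g] by fastforce
  define \<mu> where "\<mu> = ?g x0 / 2"
  have "\<mu> > 0" using simple[of x0] unfolding \<mu>_def by (cases "poly f x0 = 0") auto
  have large: "\<bar>poly f x\<bar> \<ge> \<mu> \<or> \<bar>poly (pderiv f) x\<bar> \<ge> \<mu>" if "\<bar>x\<bar> \<le> 1" for x
    using x0[of x] that by (auto simp: \<mu>_def abs_le_iff)
  \<comment> \<open>The first summand serves the \<open>T32\<close> test, the second the
    \<open>var\<close> test; the 1 makes both inequalities in \<open>small\<close> strict.\<close>
  define K where "K = 3 * (real n * (real n * (2 ^ n * M))) + 3 * (real n * M) + 1"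
  have K: "K > 0" using M(1) by (simp add: K_def add_nonneg_pos)
  show ?thesis
  proof (intro exI conjI allI impI)
    \<comment> \<open>The bound 1/2 keeps the left end of the enlarged interval in
      \<open>[-1, 1]\<close> and its width at most 1.\<close>
    show "min (1 / 2) (\<mu> / K) > 0" using \<open>\<mu> > 0\<close> K by simp
    fix I :: ivl
    assume I: "0 < width I \<and> width I \<le> min (1 / 2) (\<mu> / K) \<and> \<bar>fst I\<bar> \<le> 1 / 2"
    define a w where "a = fst I" and "w = width I"
    have w: "0 < w" "w \<le> 1 / 2" and a: "\<bar>a\<bar> \<le> 1 / 2" using I by (auto simp: a_def w_def)
    have "w * K \<le> \<mu>" using I K by (simp add: w_def pos_le_divide_eq)
    moreover have "w * (real n * (real n * (2 ^ n * M))) \<ge> 0" "w * (real n * M) \<ge> 0"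
      using w M(1) by auto
    ultimately have small: "3 * (w * (real n * (real n * (2 ^ n * M)))) < \<mu>"
      "3 * (w * (real n * M)) < \<mu>"
      using w by (auto simp: K_def algebra_simps)
    from a have "\<bar>a\<bar> \<le> 1" by simp
    from large[OF this] show "var_ivl f (enlarge (degree f) I) = 0 \<or> T32 (pderiv (ivl_poly f I)) 0 2"
    proof
      assume fa: "\<bar>poly f a\<bar> \<ge> \<mu>"
      let ?J = "enlarge n I"
      \<comment> \<open>\<open>h\<close> is the enlargement on each side, so the expansion point is
        \<open>a - h\<close>, not \<open>a\<close>. Moving from \<open>a\<close> to
        \<open>a - h\<close> costs at most \<open>w * (n * M)\<close>, and the higher coefficients
        sum to at most twice that; hence the factor 3 in \<open>K\<close>.\<close>
      define h where "h = w / (4 * real n)"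
      have "w * 1 \<le> w * (4 * real n)" using w n by (intro mult_left_mono) auto
      then have h: "0 < h" "h \<le> w" and h': "2 * h \<le> w"
        using w n by (auto simp: h_def field_simps)
      define c where "c k = coeff (f \<circ>\<^sub>p [:a - h, 1:]) k" for k
      have J: "fst ?J = a - h" "width ?J = w + 2 * h"
        using n by (auto simp: enlarge_def width_def a_def w_def h_def field_simps)
      have cM: "\<bar>c k\<bar> \<le> M" for k unfolding c_def using a w h h' by (intro M(2)) auto
      have degc: "degree (f \<circ>\<^sub>p [:a - h, 1:]) = n" by (simp add: n_def degree_pcompose)
      have "poly f a = poly (f \<circ>\<^sub>p [:a - h, 1:]) h" by (simp add: poly_pcompose)
      also have "\<dots> = c 0 + (\<Sum>k = 1..n. c k * h ^ k)"
        by (subst poly_split_coeff_0) (simp add: degc c_def)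
      finally have fa_eq: "poly f a = c 0 + (\<Sum>k = 1..n. c k * h ^ k)" .
      have "\<bar>\<Sum>k = 1..n. c k * h ^ k\<bar> \<le> (\<Sum>k = 1..n. \<bar>c k\<bar> * h ^ k)"
        using h by (intro order.trans[OF sum_abs]) (simp add: abs_mult)
      also have "\<dots> \<le> h * (real n * M)" using cM h w by (intro sum_power_le_linear) auto
      also have "\<dots> \<le> w * (real n * M)" using h M(1) by (intro mult_right_mono) auto
      finally have c0: "\<mu> - w * (real n * M) \<le> \<bar>c 0\<bar>" using fa fa_eq by linarith
      have "(\<Sum>k = 1..n. \<bar>coeff (ivl_poly f ?J) k\<bar>) = (\<Sum>k = 1..n. \<bar>c k\<bar> * (w + 2 * h) ^ k)"
        using w h by (intro sum.cong) (auto simp: coeff_ivl_poly J c_def abs_mult)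
      also have "\<dots> \<le> (w + 2 * h) * (real n * M)"
        using cM h h' w by (intro sum_power_le_linear) auto
      also have "\<dots> \<le> (2 * w) * (real n * M)" using h' M(1) by (intro mult_right_mono) auto
      also have "\<dots> < \<bar>c 0\<bar>" using c0 small(2) by linarith
      also have "c 0 = coeff (ivl_poly f ?J) 0" by (simp add: coeff_ivl_poly J c_def)
      finally have "var_ivl f ?J = 0"
        unfolding var_ivl_def n_def[symmetric] by (rule var_moebius_poly_eq_0)
      then show ?thesis by (simp add: n_def)
    next
      assume fa: "\<bar>poly (pderiv f) a\<bar> \<ge> \<mu>"
      let ?p = "pderiv (ivl_poly f I)"
      \<comment> \<open>\<open>c\<close> absorbs the factor \<open>Suc k\<close> from
        differentiation and \<open>2 ^ k\<close> from the radius of the test.\<close>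
      define c where "c k = real (Suc k) * 2 ^ k * coeff (f \<circ>\<^sub>p [:a, 1:]) (Suc k)" for k
      have coeff: "coeff ?p k = w ^ Suc k * (real (Suc k) * coeff (f \<circ>\<^sub>p [:a, 1:]) (Suc k))" for k
        by (simp add: coeff_pderiv coeff_ivl_poly a_def w_def)
      have deg: "degree ?p = n - 1"
        using w by (simp add: degree_pderiv degree_ivl_poly n_def w_def)
      \<comment> \<open>\<open>sum_power_le_linear\<close> asks for a bound at every index, so
        \<open>c\<close> is cut off where \<open>Suc k\<close> would exceed
        \<open>n\<close>.\<close>
      have c: "\<bar>if k < n then c k else 0\<bar> \<le> real n * (2 ^ n * M)" for k
      proof (cases "k < n")
        case True
        then have "real (Suc k) * (2 ^ k * \<bar>coeff (f \<circ>\<^sub>p [:a, 1:]) (Suc k)\<bar>) \<le> real n * (2 ^ n * M)"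
          using M(2)[of a] a M(1) by (intro mult_mono power_increasing) auto
        then show ?thesis using True by (simp add: c_def abs_mult mult.assoc)
      qed (use M(1) in auto)
      \<comment> \<open>The factor \<open>w\<close> in front also occurs in
        \<open>coeff ?p 0\<close>, which is \<open>w\<close> times \<open>f'(a)\<close>; the
        remaining sum is again of order \<open>w\<close>.\<close>
      have "(\<Sum>k = 1..degree ?p. \<bar>coeff ?p k\<bar> * 2 ^ k) =
            w * (\<Sum>k = 1..n - 1. \<bar>if k < n then c k else 0\<bar> * w ^ k)"
        unfolding deg sum_distrib_left using w
        by (intro sum.cong) (auto simp: coeff c_def abs_mult mult_ac)
      also have "\<dots> \<le> w * (w * (real (n - 1) * (real n * (2 ^ n * M))))"
        using c w by (intro mult_left_mono sum_power_le_linear) auto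
      also have "\<dots> \<le> w * (w * (real n * (real n * (2 ^ n * M))))"
        using w M(1) by (intro mult_left_mono mult_right_mono) auto
      finally have "3 / 2 * (\<Sum>k = 1..degree ?p. \<bar>coeff ?p k\<bar> * 2 ^ k)
          \<le> w * (3 / 2 * (w * (real n * (real n * (2 ^ n * M)))))" by simp
      also have "\<dots> < w * \<mu>"
        using w small(1) \<open>w * (real n * (real n * (2 ^ n * M))) \<ge> 0\<close>
        by (intro mult_strict_left_mono) linarith+
      also have "\<dots> \<le> w * \<bar>poly (pderiv f) a\<bar>" using fa w by simp
      also have "\<dots> = \<bar>coeff ?p 0\<bar>"
      proof -
        have "coeff ?p 0 = poly ?p 0" by (simp add: poly_0_coeff_0)
        also have "\<dots> = w * poly (pderiv f) a"
          by (simp add: ivl_poly_def pderiv_pcompose poly_pcompose pderiv_pCons a_def w_def)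
        finally show ?thesis using w by (simp add: abs_mult)
      qed
      finally show ?thesis by (simp add: T32_def t32_at_0)
    qed
  qed
qed

section \<open>Certified intervals and the loop invariant\<close>

text \<open>Stronger than \<open>isolating\<close>: the origin \<open>J\<close> of an output
  interval is remembered because \<open>f'\<close> having no zero on \<open>K\<close>, which follows
  from it, is used again for overlaps.\<close>

definition certified :: "real poly \<Rightarrow> ivl \<Rightarrow> bool" where
  "certified f K \<longleftrightarrow> poly f (fst K) * poly f (snd K) < 0 \<and>
     (\<exists>J. width J > 0 \<and> T32 (pderiv (ivl_poly f J)) 0 2 \<and> K = enlarge (degree f) J)"

lemma certified_isolating:
  assumes "certified f K" "degree f \<ge> 2"
  shows "isolating f K"
proof -
  from assms obtain J where J: "width J > 0" "T32 (pderiv (ivl_poly f J)) 0 2"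
    "K = enlarge (degree f) J" and sign: "poly f (fst K) * poly f (snd K) < 0"
    by (auto simp: certified_def)
  have "fst K < snd K" using enlarge_bounds(3)[OF J(1), of "degree f"] J(3) assms(2) by simp
  then obtain x where "fst K < x" "x < snd K" "poly f x = 0"
    using poly_IVT[OF _ sign] by blast
  moreover have "x = y" if "x \<in> ivl_set K" "poly f x = 0" "y \<in> ivl_set K" "poly f y = 0" for x y
    using that J assms(2)
    by (intro roots_eq_if_pderiv_nonzero[of x y f] pderiv_nonzero_on_enlarge[OF J(2,1) assms(2)])
      (auto simp: ivl_set_def)
  ultimately show ?thesis unfolding isolating_def by (auto simp: ivl_set_def)
qed

text \<open>On each of two overlapping enlarged intervals that pass the \<open>T32\<close> test the derivative has no
  zero, so \<open>f\<close> is injective on their union and both contain the same root.\<close>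

lemma overlapping_certified_same_root:
  assumes "certified f K" "width I > 0" "T32 (pderiv (ivl_poly f I)) 0 2" "degree f \<ge> 2"
    and "x \<in> ivl_set (enlarge (degree f) I)" "poly f x = 0"
    and "ivl_set (enlarge (degree f) I) \<inter> ivl_set K \<noteq> {}"
  shows "x \<in> ivl_set K"
proof -
  let ?I = "enlarge (degree f) I"
  from assms(1) obtain J where J: "width J > 0" "T32 (pderiv (ivl_poly f J)) 0 2"
    "K = enlarge (degree f) J"
    by (auto simp: certified_def)
  obtain y where y: "y \<in> ivl_set K" "poly f y = 0"
    using certified_isolating[OF assms(1,4)] by (auto simp: isolating_def)
  obtain z where z: "z \<in> ivl_set ?I" "z \<in> ivl_set K" using assms(7) by auto
  have "poly (pderiv f) u \<noteq> 0" if "min x y < u" "u < max x y" for u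
  proof (cases "fst ?I \<le> u \<and> u \<le> snd ?I")
    case True
    then show ?thesis using pderiv_nonzero_on_enlarge[OF assms(3,2,4)] by simp
  next
    case False
    \<comment> \<open>\<open>x\<close> and the common point \<open>z\<close> lie in
      \<open>?I\<close>, so a point \<open>u\<close> outside \<open>?I\<close> but between
      \<open>x\<close> and \<open>y\<close> lies between \<open>z\<close> and \<open>y\<close>, both
      in \<open>K\<close>.\<close>
    then have "fst K \<le> u \<and> u \<le> snd K"
      using that z y assms(5) by (auto simp: ivl_set_def min_def max_def split: if_splits)
    then show ?thesis using pderiv_nonzero_on_enlarge[OF J(2,1) assms(4)] J(3) by simp
  qed
  then have "x = y" using assms(6) y(2) by (rule roots_eq_if_pderiv_nonzero)
  with y show ?thesis by simp
qed

text \<open>Active intervals count as closed, since a midpoint may be a root and lies in neither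
  open half. Output intervals are open and contain the closed interval they were enlarged
  from.\<close>

fun dcm_inv :: "real poly \<Rightarrow> ivl set \<times> ivl list \<Rightarrow> bool" where
  "dcm_inv f (A, Out) \<longleftrightarrow>
     (\<forall>I \<in> A. width I > 0) \<and>
     (\<forall>K \<in> set Out. certified f K) \<and>
     sorted_wrt (\<lambda>J K. ivl_set J \<inter> ivl_set K = {}) Out \<and>
     (\<forall>x. poly f x = 0 \<longrightarrow>
        (\<exists>I \<in> A. x \<in> {fst I..snd I}) \<or> (\<exists>K \<in> set Out. x \<in> ivl_set K))"

text \<open>Shared by the two discarding rules: after \<open>no_root\<close> there is no root to
  cover, after \<open>reject\<close> the output already covers it.\<close>

lemma dcm_inv_discard:
  assumes inv: "dcm_inv f (A, Out)"
    and covered: "\<And>x. x \<in> {fst I..snd I} \<Longrightarrow> poly f x = 0 \<Longrightarrow> \<exists>K \<in> set Out. x \<in> ivl_set K"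
  shows "dcm_inv f (A - {I}, Out)"
proof -
  have "(\<exists>J \<in> A - {I}. x \<in> {fst J..snd J}) \<or> (\<exists>K \<in> set Out. x \<in> ivl_set K)"
    if x: "poly f x = 0" for x
  proof -
    from inv x consider J where "J \<in> A" "x \<in> {fst J..snd J}" | K where "K \<in> set Out" "x \<in> ivl_set K"
      unfolding dcm_inv.simps by blast
    then show ?thesis
    proof cases
      case 1
      then show ?thesis using covered[OF _ x] by (cases "J = I") blast+
    qed blast
  qed
  with inv show ?thesis by simp
qed

lemma dcm_inv_step:
  assumes "dcm_step f s s'" "dcm_inv f s" "degree f \<ge> 2"
  shows "dcm_inv f s'"
proof -
  have mem: "x \<in> ivl_set (enlarge (degree f) I)"
    if "width I > 0" "x \<in> {fst I..snd I}" for x I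
    using enlarge_bounds[OF that(1), of "degree f"] that(2) assms(3) by (auto simp: ivl_set_def)
  from assms(1) show ?thesis
  proof cases
    case (no_root I A Out)
    have "poly f x \<noteq> 0" if "x \<in> {fst I..snd I}" for x
      using no_root assms that by (intro no_root_if_var_ivl_eq_0[OF no_root(4)] mem) auto
    then show ?thesis
      using dcm_inv_discard[of f A Out I] assms(2) unfolding no_root(1,2) by blast
  next
    case (subdivide I A Out)
    have w: "width I > 0" using subdivide assms(2) by auto
    have "x \<in> {fst I..midpt I} \<or> x \<in> {midpt I..snd I}" if "x \<in> {fst I..snd I}" for x
      using that by auto
    moreover have "width (fst I, midpt I) > 0" "width (midpt I, snd I) > 0"
      using w by (auto simp: width_def midpt_def)
    ultimately show ?thesis using subdivide assms(2) by fastforce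
  next
    case (accept I A Out)
    have w: "width I > 0" using accept assms(2) by auto
    have "certified f (enlarge (degree f) I)"
      using accept(5,6) w unfolding certified_def dcm_accept_def by blast
    moreover have "(\<exists>J \<in> A - {I}. x \<in> {fst J..snd J}) \<or>
        (\<exists>K \<in> set (Out @ [enlarge (degree f) I]). x \<in> ivl_set K)" if "poly f x = 0" for x
    proof -
      from that assms(2) consider J where "J \<in> A" "x \<in> {fst J..snd J}"
        | K where "K \<in> set Out" "x \<in> ivl_set K"
        unfolding accept(1) dcm_inv.simps by blast
      then show ?thesis
      proof cases
        case 1
        then show ?thesis using mem[OF w, of x] by (cases "J = I") (simp, blast)
      qed auto
    qed
    moreover have "\<forall>K \<in> set Out. ivl_set K \<inter> ivl_set (enlarge (degree f) I) = {}"
      using accept(6) by (simp add: dcm_accept_def Int_commute)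
    ultimately show ?thesis
      using accept(1,2) assms(2) by (simp add: sorted_wrt_append)
  next
    case (reject I A Out)
    let ?I = "enlarge (degree f) I"
    have w: "width I > 0" using reject assms(2) by auto
    have "\<exists>K \<in> set Out. x \<in> ivl_set K" if x: "x \<in> {fst I..snd I}" "poly f x = 0" for x
    proof -
      have xI: "x \<in> ivl_set ?I" using mem[OF w x(1)] .
      \<comment> \<open>The sign condition of \<open>dcm_accept\<close> holds, so the rejection is
        due to an overlap.\<close>
      have "poly f (fst ?I) * poly f (snd ?I) < 0"
        using xI x(2) unfolding ivl_set_def greaterThanLessThan_iff
        by (intro sign_change_if_pderiv_nonzero[of _ _ f x]
            pderiv_nonzero_on_enlarge[OF reject(5) w assms(3)]) blast+
      with reject(6) obtain K where K: "K \<in> set Out" "ivl_set ?I \<inter> ivl_set K \<noteq> {}"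
        unfolding dcm_accept_def by blast
      have "certified f K" using K(1) reject assms(2) by auto
      from overlapping_certified_same_root[OF this w reject(5) assms(3) xI x(2) K(2)] K(1)
      show ?thesis by blast
    qed
    then show ?thesis
      using dcm_inv_discard[of f A Out I] assms(2) unfolding reject(1,2) by blast
  qed
qed

section \<open>Termination by a decreasing potential\<close>

fun wide_inside :: "real \<Rightarrow> ivl set \<times> ivl list \<Rightarrow> bool" where
  "wide_inside \<delta> (A, Out) \<longleftrightarrow>
     finite A \<and> (\<forall>I \<in> A. \<delta> \<le> width I \<and> - 1 / 2 \<le> fst I \<and> snd I \<le> 1 / 2)"

text \<open>Bisection preserves the total width of two halves but halves their sum of squares; hence
  the squares.\<close>

definition potential :: "ivl set \<times> ivl list \<Rightarrow> real" where
  "potential s = (\<Sum>I \<in> fst s. (width I)\<^sup>2)"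

text \<open>Removal lowers the potential by \<open>(width I)\<^sup>2\<close>, bisection by at least
  half of it. The threshold is \<open>2 * \<delta>\<close> so that the halves of a subdivided
  interval are still at least \<open>\<delta>\<close> wide.\<close>

lemma dcm_step_potential:
  assumes "dcm_step f s s'" "wide_inside \<delta> s" "\<delta> > 0"
    and small: "\<And>I. 0 < width I \<Longrightarrow> width I \<le> 2 * \<delta> \<Longrightarrow> \<bar>fst I\<bar> \<le> 1 / 2 \<Longrightarrow>
      var_ivl f (enlarge (degree f) I) = 0 \<or> T32 (pderiv (ivl_poly f I)) 0 2"
  shows "wide_inside \<delta> s' \<and> potential s' \<le> potential s - \<delta>\<^sup>2 / 2"
proof -
  have remove: "potential (A - {I}, Out') \<le> potential (A, Out) - \<delta>\<^sup>2 / 2"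
    if "I \<in> A" "wide_inside \<delta> (A, Out)" for A I Out Out'
  proof -
    have "\<delta>\<^sup>2 \<le> (width I)\<^sup>2" using that assms(3) by (intro power_mono) auto
    moreover have "potential (A, Out) = (width I)\<^sup>2 + potential (A - {I}, Out')"
      using that by (simp add: potential_def sum.remove[of A I])
    moreover have "\<delta>\<^sup>2 \<ge> 0" by simp
    ultimately show ?thesis by linarith
  qed
  from assms(1) show ?thesis
  proof cases
    case (no_root I A Out)
    with assms(2) remove show ?thesis by auto
  next
    case (accept I A Out)
    with assms(2) remove show ?thesis by auto
  next
    case (reject I A Out)
    with assms(2) remove show ?thesis by auto
  next
    case (subdivide I A Out)
    let ?L = "(fst I, midpt I)" and ?R = "(midpt I, snd I)"
    have I: "\<delta> \<le> width I" "- 1 / 2 \<le> fst I" "snd I \<le> 1 / 2" and fin: "finite A"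
      using subdivide assms(2) by auto
    have "\<bar>fst I\<bar> \<le> 1 / 2" using I assms(3) by (auto simp: width_def abs_le_iff)
    with small[of I] subdivide I(1) assms(3) have wide: "2 * \<delta> < width I" by fastforce
    have LR: "width ?L = width I / 2" "width ?R = width I / 2"
      by (auto simp: width_def midpt_def field_simps)
    have mid: "fst I < midpt I" "midpt I < snd I"
      using I(1) assms(3) by (auto simp: width_def midpt_def)
    have inside: "wide_inside \<delta> s'"
      using subdivide assms(2) wide LR mid I by auto
    \<comment> \<open>A half may already belong to the set of active intervals; such a coincidence
      only lowers the potential.\<close>
    have "potential s' = (\<Sum>J \<in> A - {I}. (width J)\<^sup>2) + (\<Sum>J \<in> {?L, ?R}. (width J)\<^sup>2)
        - (\<Sum>J \<in> (A - {I}) \<inter> {?L, ?R}. (width J)\<^sup>2)"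
      unfolding subdivide potential_def fst_conv using fin by (intro sum_Un) auto
    also have "\<dots> \<le> (\<Sum>J \<in> A - {I}. (width J)\<^sup>2) + (\<Sum>J \<in> {?L, ?R}. (width J)\<^sup>2)"
      using sum_nonneg[of "(A - {I}) \<inter> {?L, ?R}" "\<lambda>J. (width J)\<^sup>2"] by simp
    also have "(\<Sum>J \<in> {?L, ?R}. (width J)\<^sup>2) = (width I)\<^sup>2 / 2"
      using mid by (simp add: LR power_divide)
    finally have "potential s' \<le> (\<Sum>J \<in> A - {I}. (width J)\<^sup>2) + (width I)\<^sup>2 / 2" .
    moreover have "potential s = (width I)\<^sup>2 + (\<Sum>J \<in> A - {I}. (width J)\<^sup>2)"
      using fin subdivide by (simp add: potential_def sum.remove[of A I])
    moreover have "\<delta>\<^sup>2 \<le> (width I)\<^sup>2" using I assms(3) by (intro power_mono) auto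
    ultimately show ?thesis using inside by simp
  qed
qed

lemma dcm_terminates_if_simple_roots:
  fixes f :: "real poly"
  assumes "degree f > 0" "\<And>x. poly f x = 0 \<Longrightarrow> poly (pderiv f) x \<noteq> 0"
  shows "dcm_terminates f"
  unfolding dcm_terminates_def
proof
  assume "\<exists>s. s 0 = dcm_init \<and> (\<forall>i. dcm_step f (s i) (s (Suc i)))"
  then obtain s where s: "s 0 = dcm_init" "\<And>i. dcm_step f (s i) (s (Suc i))" by blast
  obtain \<epsilon> where \<epsilon>: "\<epsilon> > 0" "\<And>I. 0 < width I \<Longrightarrow> width I \<le> \<epsilon> \<Longrightarrow> \<bar>fst I\<bar> \<le> 1 / 2 \<Longrightarrow>
      var_ivl f (enlarge (degree f) I) = 0 \<or> T32 (pderiv (ivl_poly f I)) 0 2"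
    using small_ivl_not_subdivided[of f] assms by blast
  \<comment> \<open>The initial interval has width 1 and must satisfy \<open>wide_inside\<close>;
    halving gives \<open>2 * \<delta> \<le> \<epsilon>\<close>.\<close>
  define \<delta> where "\<delta> = min 1 \<epsilon> / 2"
  have \<delta>: "\<delta> > 0" "\<delta> \<le> 1" "2 * \<delta> \<le> \<epsilon>" using \<epsilon>(1) by (auto simp: \<delta>_def)
  have "wide_inside \<delta> (s i) \<and> potential (s i) \<le> 1 - real i * (\<delta>\<^sup>2 / 2)" for i
  proof (induction i)
    case 0
    then show ?case using \<delta> by (simp add: s(1) dcm_init_def potential_def width_def)
  next
    case (Suc i)
    then have "wide_inside \<delta> (s (Suc i)) \<and> potential (s (Suc i)) \<le> potential (s i) - \<delta>\<^sup>2 / 2"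
      using \<delta> \<epsilon>(2) by (intro dcm_step_potential[OF s(2)]) auto
    with Suc show ?case by (auto simp: algebra_simps add_divide_distrib)
  qed
  moreover have "potential (s i) \<ge> 0" for i by (simp add: potential_def sum_nonneg)
  ultimately have "real i * (\<delta>\<^sup>2 / 2) \<le> 1" for i by (smt (verit))
  moreover obtain i where "1 < real i * (\<delta>\<^sup>2 / 2)"
    using reals_Archimedean3[of "\<delta>\<^sup>2 / 2"] \<delta>(1) by (metis half_gt_zero zero_less_power)
  ultimately show False by (meson not_less)
qed

text \<open>If no final state were reachable, every reachable state would have a successor, and
  dependent choice would build an infinite run.\<close>

lemma dcm_returns_if_terminates:
  assumes "dcm_terminates f"
  shows "\<exists>Out. dcm_returns f Out"
proof (rule ccontr)
  assume none: "\<not> (\<exists>Out. dcm_returns f Out)"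
  let ?R = "\<lambda>s. (dcm_step f)\<^sup>*\<^sup>* dcm_init s"
  have "\<exists>s'. ?R s' \<and> dcm_step f s s'" if "?R s" for s
  proof -
    obtain A Out where s: "s = (A, Out)" by fastforce
    with none that have "A \<noteq> {}" by (auto simp: dcm_returns_def)
    from dcm_step_progress[OF this] obtain s' where "dcm_step f s s'" unfolding s by blast
    with that show ?thesis by (meson rtranclp.rtrancl_into_rtrancl)
  qed
  then have "\<exists>s. \<forall>i. (?R (s i) \<and> (i = 0 \<longrightarrow> s i = dcm_init)) \<and> dcm_step f (s i) (s (Suc i))"
    by (intro dependent_nat_choice) (use rtranclp.rtrancl_refl in blast)+
  with assms show False unfolding dcm_terminates_def by blast
qed

section \<open>Simple roots, the root bound and the conclusion\<close>

text \<open>A common zero of \<open>F\<close> and its derivative makes the square of a linear factor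
  divide \<open>F\<close>.\<close>

lemma simple_root_if_squarefree:
  fixes F :: "'a::field poly"
  assumes "squarefree F" "poly F x = 0"
  shows "poly (pderiv F) x \<noteq> 0"
proof
  assume deriv: "poly (pderiv F) x = 0"
  obtain G where G: "F = [:-x, 1:] * G" using assms(2) by (auto simp: poly_eq_0_iff_dvd)
  have "poly G x = 0"
    using deriv unfolding G pderiv_mult by (simp add: pderiv_pCons)
  then obtain H where "G = [:-x, 1:] * H" by (auto simp: poly_eq_0_iff_dvd)
  with G have "F = [:-x, 1:]\<^sup>2 * H" by (simp only: power2_eq_square mult.assoc)
  then have "[:-x, 1:]\<^sup>2 dvd F" by (rule dvdI)
  with assms(1) have "[:-x, 1:] dvd 1" by (rule squarefreeD)
  then show False by (simp add: is_unit_pCons_iff)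
qed

lemma abs_root_le_max_root_modulus:
  assumes "F \<noteq> 0" "poly F x = 0"
  shows "\<bar>x\<bar> \<le> max_root_modulus F"
proof -
  let ?F = "map_poly complex_of_real F"
  have "?F \<noteq> 0" using assms(1) by (simp add: map_poly_eq_0_iff)
  then have "finite {\<xi>. poly ?F \<xi> = 0}" by (rule poly_roots_finite)
  moreover have "poly ?F (complex_of_real x) = 0"
    proof -
    have "poly ?F (complex_of_real x) = complex_of_real (poly F x)"
      by (induction F) (auto simp: map_poly_pCons)
    then show ?thesis using assms(2) by simp
  qed
  ultimately have "cmod (complex_of_real x) \<le> max_root_modulus F"
    unfolding max_root_modulus_def by (intro Max_ge imageI) auto
  then show ?thesis by simp
qed

theorem theorem10:
  fixes F f :: "real poly" and n :: nat and \<Gamma> :: int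
  assumes "squarefree F"
    and "degree F = n" and "n \<ge> 2"
    and "\<bar>coeff F n\<bar> \<ge> 1"
    and "log 2 (max_root_modulus F) \<le> real_of_int \<Gamma>"
    and "real_of_int \<Gamma> < 4 * log 2 (real n) + log 2 (max_root_modulus F)"
    and "f = scaled_poly F \<Gamma>"
  shows "dcm_terminates f \<and>
    (\<exists>Out. dcm_returns f Out) \<and>
    (\<forall>Out. dcm_returns f Out \<longrightarrow>
       (\<forall>i j. i < length Out \<and> j < length Out \<and> i \<noteq> j \<longrightarrow>
          ivl_set (Out ! i) \<inter> ivl_set (Out ! j) = {}) \<and>
       (\<forall>I \<in> set Out. isolating f I) \<and>
       (\<forall>x. poly f x = 0 \<longrightarrow> (\<exists>I \<in> set Out. x \<in> ivl_set I)))"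
proof -
  let ?c = "2 powi (\<Gamma> + 1) :: real"
  have c: "?c > 0" by simp
  have F: "F \<noteq> 0" using assms(2,3) by auto
  have deg: "degree f = n"
    using F c assms(2) by (auto simp: assms(7) scaled_poly_def degree_pcompose)
  have root_f: "poly f x = 0 \<longleftrightarrow> poly F (?c * x) = 0" for x
    using F by (simp add: assms(7) poly_scaled_poly)
  have simple: "poly (pderiv f) x \<noteq> 0" if "poly f x = 0" for x
    using that simple_root_if_squarefree[OF assms(1), of "?c * x"] F c root_f[of x]
    by (simp add: assms(7) scaled_poly_def pderiv_smult pderiv_pcompose poly_pcompose
        pderiv_pCons mult.commute)
  have root_bound: "\<bar>x\<bar> \<le> 1 / 2" if "poly f x = 0" for x
  \<comment> \<open>A nonzero root makes \<open>max_root_modulus F\<close> positive, so that the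
    bound on its logarithm can be exponentiated.\<close>
  proof (cases "x = 0")
    case False
    have le: "\<bar>?c * x\<bar> \<le> max_root_modulus F"
      using abs_root_le_max_root_modulus[OF F] that root_f by blast
    moreover have "\<bar>?c * x\<bar> > 0" using False by simp
    ultimately have pos: "max_root_modulus F > 0" by linarith
    have "max_root_modulus F \<le> 2 powr real_of_int \<Gamma>"
      using assms(5) pos by (simp add: log_le_iff)
    also have "\<dots> = 2 powi \<Gamma>" by (simp add: powr_real_of_int')
    finally have "\<bar>?c * x\<bar> \<le> 2 powi \<Gamma>" using le by linarith
    then have "2 powi \<Gamma> * (2 * \<bar>x\<bar>) \<le> 2 powi \<Gamma> * 1"
      by (simp add: power_int_add abs_mult)
    then have "2 * \<bar>x\<bar> \<le> 1" by (rule mult_left_le_imp_le) simp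
    then show ?thesis by simp
  qed simp
  have deg2: "degree f \<ge> 2" using deg assms(3) by simp
  have terminates: "dcm_terminates f"
    using deg2 simple by (intro dcm_terminates_if_simple_roots) auto
  have init: "dcm_inv f dcm_init"
  proof -
    \<comment> \<open>Roots at the end points are included, as the invariant takes the initial
      interval as closed.\<close>
    have "x \<in> {- 1 / 2..1 / 2}" if "poly f x = 0" for x
      using root_bound[OF that] unfolding atLeastAtMost_iff by linarith
    then show ?thesis by (simp add: dcm_init_def width_def)
  qed
  have final: "dcm_inv f ({}, Out)" if "dcm_returns f Out" for Out
    using that[unfolded dcm_returns_def]
    by (induction rule: rtranclp_induct) (use init dcm_inv_step deg2 in auto)
  have "ivl_set (Out ! i) \<inter> ivl_set (Out ! j) = {}"
    if "dcm_returns f Out" "i < length Out" "j < length Out" "i \<noteq> j" for Out i j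
    using final[OF that(1)] that(2-4)
    by (cases i j rule: linorder_cases) (auto simp: sorted_wrt_iff_nth_less Int_commute)
  moreover have "(\<forall>I \<in> set Out. isolating f I) \<and>
      (\<forall>x. poly f x = 0 \<longrightarrow> (\<exists>I \<in> set Out. x \<in> ivl_set I))" if "dcm_returns f Out" for Out
    using final[OF that] certified_isolating[OF _ deg2] by auto
  ultimately show ?thesis
    using terminates dcm_returns_if_terminates[OF terminates] by blast
qed

end
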